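(* Let $X_0=(X_{0,1},\ldots,X_{0,p})^T$ be a random vector satisfying the structural equations model $$X_{0,1}=\epsilon_{0,1},\qquad X_{0,j}=\sum_{k=1}^{j-1}X_{0,k}\beta_{k,j}+\epsilon_{0,j},\quad j=2,\ldots,p,$$ with real constants $\beta_{k,j}$, where $\{\epsilon_{0,j}\}_{j=1}^p$ is a martingale difference array for a filtration $\{\mathcal{F}_j\}_{j=0}^p$ (that is, $\epsilon_{0,j}$ is $\mathcal{F}_j$-measurable and $\mathbb{E}(\epsilon_{0,j}\mid\mathcal{F}_{j-1})=0$), $X_{0,j}$ is $\mathcal{F}_j$-measurable for $j=1,\ldots,p$, and $\omega_j^2:=\mathrm{var}(\epsilon_{0,j})$ exists and is positive for all $j$. Assume in addition that for some constant $C$ and for all $\lambda\in\mathbb{R}$, $$\mathbb{E}\big(\exp[\lambda\epsilon_{0,j}/\omega_j]\,\big|\,\mathcal{F}_{j-1}\big)\le\exp[\lambda^2C^2/2],\qquad j=1,\ldots,p.$$ Then the random vector $X_0$ is sub-Gaussian with constant $C$.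
   Context: A real random variable $Z$ is sub-Gaussian with constant $C$ if $\mathbb{E}\exp[\lambda|Z|]\le2\exp[\lambda^2C^2/2]$ for all $\lambda>0$. A random vector $X_0\in\mathbb{R}^p$ is sub-Gaussian with constant $C$ if for all $u\in\mathbb{R}^p$ with $\mathbb{E}(X_0^Tu)^2=1$ the random variable $X_0^Tu$ is sub-Gaussian with constant $C$. *)

theory Defs
  imports "HOL-Probability.Probability"
begin

(* The moment generating bound is stated with the nonnegative integral, so that it also
   asserts finiteness of the expectation (the Bochner integral of a non-integrable function
   would be 0). *)
definition sub_gaussian :: "'a measure \<Rightarrow> ('a \<Rightarrow> real) \<Rightarrow> real \<Rightarrow> bool" where
  "sub_gaussian M Z C \<longleftrightarrow>
     Z \<in> borel_measurable M \<and>
     (\<forall>l>0. (\<integral>\<^sup>+ x. ennreal (exp (l * \<bar>Z x\<bar>)) \<partial>M) \<le> ennreal (2 * exp (l\<^sup>2 * C\<^sup>2 / 2)))"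

(* A random vector in R^p is a family X 1, ..., X p of real random variables; values of X and
   of u at indices outside {1..p} are irrelevant.  The equation for the second moment forces
   square integrability, since the Bochner integral is 0 otherwise. *)
definition sub_gaussian_vector :: "'a measure \<Rightarrow> nat \<Rightarrow> (nat \<Rightarrow> 'a \<Rightarrow> real) \<Rightarrow> real \<Rightarrow> bool" where
  "sub_gaussian_vector M p X C \<longleftrightarrow>
     (\<forall>j\<in>{1..p}. X j \<in> borel_measurable M) \<and>
     (\<forall>u :: nat \<Rightarrow> real.
        prob_space.expectation M (\<lambda>x. (\<Sum>j=1..p. X j x * u j)\<^sup>2) = 1 \<longrightarrow>
        sub_gaussian M (\<lambda>x. \<Sum>j=1..p. X j x * u j) C)"

(* The index set is {0..p}; the library locale filtration ranges over a whole index type and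
   does not relate the sigma-algebras to an ambient measure. *)
definition finite_filtration :: "'a measure \<Rightarrow> nat \<Rightarrow> (nat \<Rightarrow> 'a measure) \<Rightarrow> bool" where
  "finite_filtration M p F \<longleftrightarrow>
     (\<forall>j\<le>p. subalgebra M (F j)) \<and>
     (\<forall>i j. i \<le> j \<longrightarrow> j \<le> p \<longrightarrow> sets (F i) \<subseteq> sets (F j))"

definition martingale_difference_array ::
    "'a measure \<Rightarrow> nat \<Rightarrow> (nat \<Rightarrow> 'a measure) \<Rightarrow> (nat \<Rightarrow> 'a \<Rightarrow> real) \<Rightarrow> bool" where
  "martingale_difference_array M p F \<epsilon> \<longleftrightarrow>
     finite_filtration M p F \<and>
     (\<forall>j\<in>{1..p}. \<epsilon> j \<in> borel_measurable (F j) \<and> integrable M (\<epsilon> j) \<and>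
        (AE x in M. real_cond_exp M (F (j - 1)) (\<epsilon> j) x = 0))"

end

theory Submission
  imports Defs
begin

text \<open>
  Eliminating the structural equations one by one writes every linear combination
  \<open>X\<^sup>T u\<close> as a combination \<open>\<Sum>j. \<epsilon>\<^sub>j v\<^sub>j\<close> of the noise. The summands are orthogonal, so
  \<open>\<Sum>j. v\<^sub>j\<^sup>2 \<omega>\<^sub>j\<^sup>2 = 1\<close> when the second moment is 1. Conditioning successively
  on \<open>F\<^sub>p\<^sub>-\<^sub>1, \<dots>, F\<^sub>0\<close> bounds the moment generating function of the combination by
  \<open>\<Prod>j. exp (\<lambda>\<^sup>2 v\<^sub>j\<^sup>2 \<omega>\<^sub>j\<^sup>2 C\<^sup>2 / 2) = exp (\<lambda>\<^sup>2 C\<^sup>2 / 2)\<close>, and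
  \<open>exp (\<lambda>\<bar>z\<bar>) \<le> exp (\<lambda>z) + exp (-\<lambda>z)\<close> gives the factor 2.
\<close>

text \<open>The system is triangular, so substituting the last equation leaves a combination of the
  earlier variables and one noise term. The coefficients change with each substitution, hence the
  induction is over all \<open>u\<close>.\<close>

lemma structural_equations_eliminate:
  fixes X \<epsilon> :: "nat \<Rightarrow> 'a \<Rightarrow> real" and \<beta> :: "nat \<Rightarrow> nat \<Rightarrow> real" and u :: "nat \<Rightarrow> real"
  assumes "\<And>j. j \<in> {1..p} \<Longrightarrow> AE x in M. X j x = (\<Sum>k=1..j-1. X k x * \<beta> k j) + \<epsilon> j x"
  shows "\<exists>v. AE x in M. (\<Sum>j=1..p. X j x * u j) = (\<Sum>j=1..p. \<epsilon> j x * v j)"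
  using assms
proof (induction p arbitrary: u)
  case 0
  then show ?case by simp
next
  case (Suc p)
  \<comment> \<open>Replacing \<open>X (Suc p)\<close> by its equation adds
    \<open>\<beta> k (Suc p) * u (Suc p)\<close> to the coefficient of \<open>X k\<close>.\<close>
  let ?w = "\<lambda>k. u k + \<beta> k (Suc p) * u (Suc p)"
  have "\<exists>v. AE x in M. (\<Sum>j=1..p. X j x * ?w j) = (\<Sum>j=1..p. \<epsilon> j x * v j)"
    by (rule Suc.IH) (rule Suc.prems, simp)
  then obtain v where v: "AE x in M. (\<Sum>j=1..p. X j x * ?w j) = (\<Sum>j=1..p. \<epsilon> j x * v j)"
    by blast
  have X: "AE x in M. X (Suc p) x = (\<Sum>k=1..p. X k x * \<beta> k (Suc p)) + \<epsilon> (Suc p) x"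
    using Suc.prems[of "Suc p"] by simp
  \<comment> \<open>The new noise term enters only through the last equation, so it keeps the
    coefficient \<open>u (Suc p)\<close>.\<close>
  let ?v = "v(Suc p := u (Suc p))"
  have "AE x in M. (\<Sum>j=1..Suc p. X j x * u j) = (\<Sum>j=1..Suc p. \<epsilon> j x * ?v j)"
    using v X
  proof eventually_elim
    case (elim x)
    have "(\<Sum>j=1..p. \<epsilon> j x * ?v j) = (\<Sum>j=1..p. \<epsilon> j x * v j)"
      by (rule sum.cong) auto
    with elim show ?case
      by (simp add: distrib_left distrib_right sum.distrib sum_distrib_right mult.assoc)
  qed
  then show ?case by blast
qed

text \<open>The product is dominated by the sum of the squares, by 2ab \<le> a^2 + b^2 applied to
  absolute values.\<close>

lemma integrable_mult_of_squares:
  fixes f g :: "'a \<Rightarrow> real"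
  assumes [measurable]: "f \<in> borel_measurable M" "g \<in> borel_measurable M"
    and "integrable M (\<lambda>x. (f x)\<^sup>2)" "integrable M (\<lambda>x. (g x)\<^sup>2)"
  shows "integrable M (\<lambda>x. f x * g x)"
proof (rule Bochner_Integration.integrable_bound)
  show "integrable M (\<lambda>x. (f x)\<^sup>2 + (g x)\<^sup>2)"
    using assms by simp
  show "AE x in M. norm (f x * g x) \<le> norm ((f x)\<^sup>2 + (g x)\<^sup>2)"
  proof (rule AE_I2)
    fix x
    have "\<bar>f x\<bar> * \<bar>g x\<bar> * 2 \<le> \<bar>f x\<bar>\<^sup>2 + \<bar>g x\<bar>\<^sup>2"
      using sum_squares_bound[of "\<bar>f x\<bar>" "\<bar>g x\<bar>"] by (simp add: mult_ac)
    moreover have "0 \<le> \<bar>f x\<bar> * \<bar>g x\<bar>"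
      by simp
    ultimately have "\<bar>f x\<bar> * \<bar>g x\<bar> \<le> \<bar>f x\<bar>\<^sup>2 + \<bar>g x\<bar>\<^sup>2"
      by linarith
    then show "norm (f x * g x) \<le> norm ((f x)\<^sup>2 + (g x)\<^sup>2)"
      by (simp add: abs_mult)
  qed
qed simp

text \<open>An \<open>F\<close>-measurable factor passes through the conditional expectation. This
  is the source of orthogonality below.\<close>

lemma (in sigma_finite_subalgebra) integral_mult_cond_exp_zero:
  fixes f g :: "'a \<Rightarrow> real"
  assumes "f \<in> borel_measurable F" "g \<in> borel_measurable M"
    and "integrable M (\<lambda>x. f x * g x)" "AE x in M. real_cond_exp M F g x = 0"
  shows "(\<integral>x. f x * g x \<partial>M) = 0"
proof -
  have "(\<integral>x. f x * g x \<partial>M) = (\<integral>x. f x * real_cond_exp M F g x \<partial>M)"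
    using assms by (simp add: real_cond_exp_intg(2))
  also have "\<dots> = 0"
    using assms(4) by (intro integral_eq_zero_AE) auto
  finally show ?thesis .
qed

context prob_space
begin

text \<open>A probability measure restricted to a subalgebra is still finite, so the conditional
  expectation results apply to each \<open>F j\<close>.\<close>

lemma sigma_finite_subalgebra_filtration:
  assumes "finite_filtration M p F" "j \<le> p"
  shows "sigma_finite_subalgebra M (F j)"
proof -
  have "finite_measure_subalgebra M (F j)"
    using assms by unfold_locales (simp add: finite_filtration_def)
  then show ?thesis
    by (rule finite_measure_subalgebra_is_sigma_finite)
qed

lemma finite_filtration_measurable_mono:
  assumes "finite_filtration M p F" "i \<le> j" "j \<le> p" "f \<in> borel_measurable (F i)"
  shows "f \<in> borel_measurable (F j)"
proof -
  have "measurable (F i) borel \<subseteq> measurable (F j) borel"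
    using assms by (intro measurable_mono) (auto simp: finite_filtration_def subalgebra_def)
  with assms(4) show ?thesis by blast
qed

lemma finite_filtration_measurable_ambient:
  assumes "finite_filtration M p F" "j \<le> p" "f \<in> borel_measurable (F j)"
  shows "f \<in> borel_measurable M"
  using assms by (auto simp: finite_filtration_def intro: measurable_from_subalg)

text \<open>Adaptedness of the partial sums: the first \<open>m\<close> terms act as constants when
  the next one is conditioned on \<open>F m\<close>.\<close>

lemma borel_measurable_partial_sum:
  assumes "martingale_difference_array M p F \<epsilon>" "m \<le> p"
  shows "(\<lambda>x. \<Sum>j=1..m. \<epsilon> j x * v j) \<in> borel_measurable (F m)"
proof (intro borel_measurable_sum borel_measurable_times borel_measurable_const)
  fix j assume "j \<in> {1..m}"
  with assms show "\<epsilon> j \<in> borel_measurable (F m)"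
    by (intro finite_filtration_measurable_mono[of p F j m])
       (auto simp: martingale_difference_array_def)
qed

text \<open>Orthogonality to the constant 1. It turns the variance of \<open>\<epsilon> j\<close>
  into its second moment.\<close>

lemma martingale_difference_mean_zero:
  assumes "martingale_difference_array M p F \<epsilon>" "j \<in> {1..p}"
  shows "expectation (\<epsilon> j) = 0"
proof -
  interpret sigma_finite_subalgebra M "F (j - 1)"
    using assms
    by (intro sigma_finite_subalgebra_filtration[of p]) (auto simp: martingale_difference_array_def)
  have "(\<integral>x. 1 * \<epsilon> j x \<partial>M) = 0"
    using assms by (intro integral_mult_cond_exp_zero) (auto simp: martingale_difference_array_def)
  then show ?thesis by simp
qed

text \<open>Pythagoras for orthogonal increments. Integrability is carried through the induction
  because expanding the expectation of the square requires it.\<close>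

lemma martingale_difference_second_moment:
  assumes mda: "martingale_difference_array M p F \<epsilon>"
    and sq: "\<And>j. j \<in> {1..p} \<Longrightarrow> integrable M (\<lambda>x. (\<epsilon> j x)\<^sup>2)"
    and "m \<le> p"
  shows "integrable M (\<lambda>x. (\<Sum>j=1..m. \<epsilon> j x * v j)\<^sup>2) \<and>
    expectation (\<lambda>x. (\<Sum>j=1..m. \<epsilon> j x * v j)\<^sup>2) = (\<Sum>j=1..m. (v j)\<^sup>2 * variance (\<epsilon> j))"
  using \<open>m \<le> p\<close>
proof (induction m)
  case 0
  then show ?case by simp
next
  case (Suc m)
  let ?S = "\<lambda>x. \<Sum>j=1..m. \<epsilon> j x * v j" and ?e = "\<epsilon> (Suc m)" and ?a = "v (Suc m)"
  have IH: "integrable M (\<lambda>x. (?S x)\<^sup>2)"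
    "expectation (\<lambda>x. (?S x)\<^sup>2) = (\<Sum>j=1..m. (v j)\<^sup>2 * variance (\<epsilon> j))"
    using Suc by auto
  have filt: "finite_filtration M p F"
    using mda by (simp add: martingale_difference_array_def)
  interpret sigma_finite_subalgebra M "F m"
    using Suc.prems filt by (intro sigma_finite_subalgebra_filtration[of p]) auto
  have S: "?S \<in> borel_measurable (F m)"
    using mda Suc.prems by (intro borel_measurable_partial_sum) auto
  have e: "integrable M ?e" "AE x in M. real_cond_exp M (F m) ?e x = 0"
    using mda Suc.prems by (auto simp: martingale_difference_array_def dest!: bspec[of _ _ "Suc m"])
  have sqe: "integrable M (\<lambda>x. (?e x)\<^sup>2)"
    using sq[of "Suc m"] Suc.prems by simp
  have "?S \<in> borel_measurable M"
    using finite_filtration_measurable_ambient[OF filt _ S] Suc.prems by simp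
  then have Se: "integrable M (\<lambda>x. ?S x * ?e x)"
    using e(1) IH(1) sqe by (intro integrable_mult_of_squares) auto
  \<comment> \<open>The cross term vanishes: \<open>?S\<close> is known at time \<open>m\<close>,
    and \<open>?e\<close> has conditional mean zero given \<open>F m\<close>.\<close>
  have orth: "expectation (\<lambda>x. ?S x * ?e x) = 0"
    using S e Se by (intro integral_mult_cond_exp_zero) auto
  have var: "variance ?e = expectation (\<lambda>x. (?e x)\<^sup>2)"
    using martingale_difference_mean_zero[OF mda, of "Suc m"] Suc.prems by simp
  have expand: "(\<Sum>j=1..Suc m. \<epsilon> j x * v j)\<^sup>2
      = (?S x)\<^sup>2 + 2 * ?a * (?S x * ?e x) + ?a\<^sup>2 * (?e x)\<^sup>2" for x
    by (simp add: power2_eq_square algebra_simps)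
  have "integrable M (\<lambda>x. (\<Sum>j=1..Suc m. \<epsilon> j x * v j)\<^sup>2)"
    unfolding expand using IH(1) Se sqe by simp
  moreover have "expectation (\<lambda>x. (\<Sum>j=1..Suc m. \<epsilon> j x * v j)\<^sup>2)
      = expectation (\<lambda>x. (?S x)\<^sup>2) + 2 * ?a * expectation (\<lambda>x. ?S x * ?e x)
        + ?a\<^sup>2 * expectation (\<lambda>x. (?e x)\<^sup>2)"
    unfolding expand using IH(1) Se sqe by simp
  ultimately show ?case
    using IH(2) orth var by simp
qed

text \<open>Each step splits off the last exponential factor and replaces it by its conditional
  bound, which is deterministic and leaves the integral. With nonnegative integrals, finiteness need
  not be known beforehand.\<close>

lemma martingale_difference_mgf_bound:
  assumes mda: "martingale_difference_array M p F \<epsilon>"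
    and pos: "\<And>j. j \<in> {1..p} \<Longrightarrow> \<omega> j > 0"
    and mgf: "\<And>j l. j \<in> {1..p} \<Longrightarrow>
           AE x in M. nn_cond_exp M (F (j - 1)) (\<lambda>y. ennreal (exp (l * \<epsilon> j y / \<omega> j))) x
                        \<le> ennreal (exp (l\<^sup>2 * C\<^sup>2 / 2))"
    and "m \<le> p"
  shows "(\<integral>\<^sup>+ x. ennreal (exp (l * (\<Sum>j=1..m. \<epsilon> j x * v j))) \<partial>M)
    \<le> ennreal (exp (l\<^sup>2 * C\<^sup>2 / 2 * (\<Sum>j=1..m. (v j)\<^sup>2 * (\<omega> j)\<^sup>2)))"
  using \<open>m \<le> p\<close>
proof (induction m)
  case 0
  then show ?case by (simp add: emeasure_space_1)
next
  case (Suc m)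
  let ?S = "\<lambda>x. \<Sum>j=1..m. \<epsilon> j x * v j" and ?e = "\<epsilon> (Suc m)"
  \<comment> \<open>The assumed bound concerns \<open>\<epsilon> j / \<omega> j\<close>; with this
    parameter the exponent becomes \<open>l * ?e x * v (Suc m)\<close>, and
    \<open>?k\<^sup>2\<close> produces the weight of the new term.\<close>
  let ?k = "l * v (Suc m) * \<omega> (Suc m)"
  let ?f = "\<lambda>x. ennreal (exp (l * ?S x))"
  let ?g = "\<lambda>x. ennreal (exp (?k * ?e x / \<omega> (Suc m)))"
  have filt: "finite_filtration M p F"
    using mda by (simp add: martingale_difference_array_def)
  interpret sigma_finite_subalgebra M "F m"
    using Suc.prems filt by (intro sigma_finite_subalgebra_filtration[of p]) auto
  \<comment> \<open>Stated for any \<open>N\<close>, since both \<open>F m\<close> and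
    \<open>M\<close> are needed.\<close>
  have exp_meas: "(\<lambda>x. ennreal (exp (l * h x))) \<in> borel_measurable N"
    if [measurable]: "h \<in> borel_measurable N" for h :: "'a \<Rightarrow> real" and N
    by measurable
  have S: "?S \<in> borel_measurable (F m)"
    using mda Suc.prems by (intro borel_measurable_partial_sum) auto
  have fF: "?f \<in> borel_measurable (F m)"
    by (rule exp_meas[OF S])
  have fM: "?f \<in> borel_measurable M"
    using finite_filtration_measurable_ambient[OF filt _ S] Suc.prems by (intro exp_meas) simp
  have [measurable]: "?e \<in> borel_measurable M"
    using mda Suc.prems
    by (auto simp: martingale_difference_array_def dest!: bspec[of _ _ "Suc m"])
  have \<omega>: "\<omega> (Suc m) > 0"
    using pos Suc.prems by simp
  have "(\<integral>\<^sup>+ x. ennreal (exp (l * (\<Sum>j=1..Suc m. \<epsilon> j x * v j))) \<partial>M) = (\<integral>\<^sup>+ x. ?f x * ?g x \<partial>M)"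
    using \<omega> by (intro nn_integral_cong)
      (simp add: ennreal_mult[symmetric] exp_add[symmetric] algebra_simps)
  also have "\<dots> = (\<integral>\<^sup>+ x. ?f x * nn_cond_exp M (F m) ?g x \<partial>M)"
    by (rule nn_cond_exp_intg[symmetric, OF fF]) measurable
  also have "\<dots> \<le> (\<integral>\<^sup>+ x. ?f x * ennreal (exp (?k\<^sup>2 * C\<^sup>2 / 2)) \<partial>M)"
  proof (rule nn_integral_mono_AE)
    have "AE x in M. nn_cond_exp M (F m) ?g x \<le> ennreal (exp (?k\<^sup>2 * C\<^sup>2 / 2))"
      using mgf[of "Suc m" ?k] Suc.prems by simp
    then show "AE x in M. ?f x * nn_cond_exp M (F m) ?g x \<le> ?f x * ennreal (exp (?k\<^sup>2 * C\<^sup>2 / 2))"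
      by eventually_elim (rule mult_left_mono, auto)
  qed
  also have "\<dots> = (\<integral>\<^sup>+ x. ?f x \<partial>M) * ennreal (exp (?k\<^sup>2 * C\<^sup>2 / 2))"
    by (rule nn_integral_multc[OF fM])
  also have "\<dots> \<le> ennreal (exp (l\<^sup>2 * C\<^sup>2 / 2 * (\<Sum>j=1..m. (v j)\<^sup>2 * (\<omega> j)\<^sup>2)))
      * ennreal (exp (?k\<^sup>2 * C\<^sup>2 / 2))"
    using Suc by (intro mult_right_mono) auto
  also have "\<dots> = ennreal (exp (l\<^sup>2 * C\<^sup>2 / 2 * (\<Sum>j=1..Suc m. (v j)\<^sup>2 * (\<omega> j)\<^sup>2)))"
    by (simp add: ennreal_mult[symmetric] exp_add[symmetric] power_mult_distrib algebra_simps)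
  finally show ?case .
qed

end

text \<open>The bound on the signed exponential is used at \<open>l\<close> and at
  \<open>- l\<close>; its right side is even in \<open>l\<close>, so the two add up to the factor
  2.\<close>

lemma sub_gaussianI_mgf:
  assumes [measurable]: "Z \<in> borel_measurable M"
    and mgf: "\<And>l. (\<integral>\<^sup>+ x. ennreal (exp (l * Z x)) \<partial>M) \<le> ennreal (exp (l\<^sup>2 * C\<^sup>2 / 2))"
  shows "sub_gaussian M Z C"
  unfolding sub_gaussian_def
proof (intro conjI allI impI)
  fix l :: real
  \<comment> \<open>Whatever the sign of \<open>Z x\<close>, one summand equals the left side and
    the other is nonnegative.\<close>
  have "(\<integral>\<^sup>+ x. ennreal (exp (l * \<bar>Z x\<bar>)) \<partial>M)
      \<le> (\<integral>\<^sup>+ x. ennreal (exp (l * Z x)) + ennreal (exp (- l * Z x)) \<partial>M)"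
    by (intro nn_integral_mono) (auto simp: abs_if ennreal_plus[symmetric] simp del: ennreal_plus)
  also have "\<dots> = (\<integral>\<^sup>+ x. ennreal (exp (l * Z x)) \<partial>M) + (\<integral>\<^sup>+ x. ennreal (exp (- l * Z x)) \<partial>M)"
    by (rule nn_integral_add) measurable
  also have "\<dots> \<le> ennreal (exp (l\<^sup>2 * C\<^sup>2 / 2)) + ennreal (exp (l\<^sup>2 * C\<^sup>2 / 2))"
    using mgf[of l] mgf[of "- l"] by (intro add_mono) simp_all
  also have "\<dots> = ennreal (2 * exp (l\<^sup>2 * C\<^sup>2 / 2))"
    by (simp add: ennreal_plus[symmetric] del: ennreal_plus)
  finally show "(\<integral>\<^sup>+ x. ennreal (exp (l * \<bar>Z x\<bar>)) \<partial>M) \<le> ennreal (2 * exp (l\<^sup>2 * C\<^sup>2 / 2))" .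
qed fact

theorem lemma8p1:
  fixes M :: "'a measure" and p :: nat and F :: "nat \<Rightarrow> 'a measure"
    and X \<epsilon> :: "nat \<Rightarrow> 'a \<Rightarrow> real" and \<beta> :: "nat \<Rightarrow> nat \<Rightarrow> real"
    and \<omega> :: "nat \<Rightarrow> real" and C :: real
  assumes "prob_space M"
    and "1 \<le> p"
    and "AE x in M. X 1 x = \<epsilon> 1 x"
    and "\<And>j. j \<in> {2..p} \<Longrightarrow> AE x in M. X j x = (\<Sum>k=1..j-1. X k x * \<beta> k j) + \<epsilon> j x"
    and "martingale_difference_array M p F \<epsilon>"
    and "\<And>j. j \<in> {1..p} \<Longrightarrow> X j \<in> borel_measurable (F j)"
    and "\<And>j. j \<in> {1..p} \<Longrightarrow> integrable M (\<lambda>x. (\<epsilon> j x)\<^sup>2)"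
    and "\<And>j. j \<in> {1..p} \<Longrightarrow> \<omega> j > 0 \<and> (\<omega> j)\<^sup>2 = prob_space.variance M (\<epsilon> j)"
    and "\<And>j l. j \<in> {1..p} \<Longrightarrow>
           AE x in M. nn_cond_exp M (F (j - 1)) (\<lambda>y. ennreal (exp (l * \<epsilon> j y / \<omega> j))) x
                        \<le> ennreal (exp (l\<^sup>2 * C\<^sup>2 / 2))"
  shows "sub_gaussian_vector M p X C"
proof -
  interpret prob_space M by fact
  have filt: "finite_filtration M p F"
    using assms(5) by (simp add: martingale_difference_array_def)
  have X_meas: "X j \<in> borel_measurable M" if "j \<in> {1..p}" for j
    using finite_filtration_measurable_ambient[OF filt _ assms(6)[OF that]] that by simp
  \<comment> \<open>For \<open>j = 1\<close> the sum over \<open>{1..0}\<close> is empty, so the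
    first equation takes the general form.\<close>
  have sem: "AE x in M. X j x = (\<Sum>k=1..j-1. X k x * \<beta> k j) + \<epsilon> j x" if "j \<in> {1..p}" for j
    using that assms(3) assms(4)[of j] by (cases "j = 1") auto
  have "sub_gaussian M (\<lambda>x. \<Sum>j=1..p. X j x * u j) C"
    if norm: "expectation (\<lambda>x. (\<Sum>j=1..p. X j x * u j)\<^sup>2) = 1" for u
  proof -
    let ?Z = "\<lambda>x. \<Sum>j=1..p. X j x * u j"
    have Z_meas: "?Z \<in> borel_measurable M"
      using X_meas by (intro borel_measurable_sum borel_measurable_times) auto
    obtain v where v: "AE x in M. ?Z x = (\<Sum>j=1..p. \<epsilon> j x * v j)"
      using structural_equations_eliminate[OF sem] by blast
    let ?V = "\<lambda>x. \<Sum>j=1..p. \<epsilon> j x * v j"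
    have V_meas: "?V \<in> borel_measurable M"
      using finite_filtration_measurable_ambient[OF filt _ borel_measurable_partial_sum[OF assms(5)]]
      by simp
    \<comment> \<open>The normalisation of \<open>?Z\<close> is transferred to \<open>?V\<close>,
      where orthogonality reads it as a condition on the coefficients \<open>v\<close>.\<close>
    have "expectation (\<lambda>x. (?Z x)\<^sup>2) = expectation (\<lambda>x. (?V x)\<^sup>2)"
      using v Z_meas V_meas by (intro integral_cong_AE) auto
    also have "\<dots> = (\<Sum>j=1..p. (v j)\<^sup>2 * variance (\<epsilon> j))"
      using martingale_difference_second_moment[OF assms(5,7), of p] by simp
    also have "\<dots> = (\<Sum>j=1..p. (v j)\<^sup>2 * (\<omega> j)\<^sup>2)"
      using assms(8) by (intro sum.cong) auto
    finally have weights: "(\<Sum>j=1..p. (v j)\<^sup>2 * (\<omega> j)\<^sup>2) = 1"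
      using norm by simp
    show ?thesis
    proof (rule sub_gaussianI_mgf[OF Z_meas])
      fix l
      have "(\<integral>\<^sup>+ x. ennreal (exp (l * ?Z x)) \<partial>M) = (\<integral>\<^sup>+ x. ennreal (exp (l * ?V x)) \<partial>M)"
        using v by (intro nn_integral_cong_AE) auto
      \<comment> \<open>By \<open>weights\<close> the sum in this exponent is 1, which leaves
        exactly the constant \<open>C\<close>.\<close>
      also have "\<dots> \<le> ennreal (exp (l\<^sup>2 * C\<^sup>2 / 2 * (\<Sum>j=1..p. (v j)\<^sup>2 * (\<omega> j)\<^sup>2)))"
        using assms(8) by (intro martingale_difference_mgf_bound[OF assms(5) _ assms(9)]) auto
      finally show "(\<integral>\<^sup>+ x. ennreal (exp (l * ?Z x)) \<partial>M) \<le> ennreal (exp (l\<^sup>2 * C\<^sup>2 / 2))"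
        unfolding weights by simp
    qed
  qed
  with X_meas show ?thesis
    by (simp add: sub_gaussian_vector_def)
qed

end
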